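(* Let $d, D \in \mathbb{N}$ and $\epsilon > 0$. Let $\{\alpha_n\}_{n\ge 1}$ be a sequence of algebraic integers such that: (i) $\max_n \deg \alpha_n = d$; (ii) $|\alpha_n| = \overline{|\alpha_n|}$ for every $n$, i.e. $\alpha_n$ has maximal modulus among its conjugates; (iii) $|\alpha_n|$ is non-decreasing in $n$; (iv) $|\alpha_n| \ge n^{1+\epsilon}$ for all sufficiently large $n$; (v) either $\mathrm{Re}(\alpha_n) > 0$ for all $n$, or $\mathrm{Im}(\alpha_n) > 0$ for all $n$; (vi) $\displaystyle \limsup_{n \to \infty} \overline{|\alpha_n|}^{\,1/\left(D^n \prod_{i=1}^{n-1}(d^i + d)\right)} = \infty.$ Then $$\deg\left(\sum_{n=1}^\infty \frac{1}{\alpha_n}\right) > D.$$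
   Context: For an algebraic number $\alpha$, the house $\overline{|\alpha|}$ is the maximum of $|\alpha'|$ over all complex conjugates $\alpha'$ of $\alpha$. The degree of an algebraic number is the degree of its minimal polynomial over $\mathbb{Q}$; the degree of a transcendental number is defined to be $\infty$. The empty product (for $n=1$) equals $1$. *)

theory Defs
  imports "HOL-Analysis.Analysis" "HOL-Computational_Algebra.Polynomial" "HOL-Library.Extended_Nat"
begin

definition rat_poly :: "complex poly \<Rightarrow> bool" where
  "rat_poly p \<longleftrightarrow> (\<forall>i. coeff p i \<in> \<rat>)"

definition min_poly :: "complex \<Rightarrow> complex poly" where
  "min_poly x = (SOME p. rat_poly p \<and> lead_coeff p = 1 \<and> poly p x = 0 \<and>
      (\<forall>q. rat_poly q \<and> q \<noteq> 0 \<and> poly q x = 0 \<longrightarrow> degree p \<le> degree q))"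

definition alg_degree :: "complex \<Rightarrow> enat" where
  "alg_degree x = (if algebraic x then enat (degree (min_poly x)) else \<infinity>)"

definition conjugates :: "complex \<Rightarrow> complex set" where
  "conjugates x = {z. poly (min_poly x) z = 0}"

definition house :: "complex \<Rightarrow> real" where
  "house x = Max (norm ` conjugates x)"

end

theory Submission
  imports Defs
    "HOL-Computational_Algebra.Polynomial_FPS"
    "HOL-Computational_Algebra.Fundamental_Theorem_Algebra"
begin

text \<open>
  Suppose the sum \<open>s\<close> has degree at most \<open>D\<close>. Write \<open>a n = norm (\<alpha> n)\<close>,
  \<open>b n = max 1 (a n)\<close> and \<open>K = D * d ^ n\<close>. The tail \<open>s - (\<Sum>i\<le>n. 1 / \<alpha> i)\<close> is nonzero by the
  condition on real or imaginary parts. Multiplying it by \<open>A * (\<Prod>i\<le>n. \<alpha> i)\<close>, with \<open>A\<close> a common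
  denominator of the minimal polynomial of \<open>s\<close>, and taking the product over all choices of
  conjugates of \<open>s\<close> and of the \<open>\<alpha> i\<close> gives the Liouville-type bound
  \<open>1 \<le> norm (tail n) * (C * (\<Prod>i\<le>n. b i)) ^ K\<close> with \<open>C\<close> independent of \<open>n\<close>. Hence for
  every \<open>n\<close> some \<open>j \<ge> 1\<close> satisfies \<open>a (n + j) \<le> const * (C * (\<Prod>i\<le>n. b i)) ^ K * j powr (1 + \<epsilon>/2)\<close>,
  since otherwise the tail would be too small. As \<open>a\<close> is non-decreasing, this bounds
  \<open>\<Sum>i\<le>n+j. ln (b i)\<close> by a multiple \<open>1 + j * K\<close> of \<open>\<Sum>i\<le>n. ln (b i)\<close> plus lower-order terms, and the
  exponents of the limsup condition grow at least as fast from \<open>n\<close> to \<open>n + j\<close>. The growth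
  condition bounds \<open>ln j\<close>, so \<open>ln (a m)\<close> is at most a constant times the exponent at \<open>m\<close> for
  every large \<open>m\<close>, contradicting the limsup condition.
\<close>

subsection \<open>Newton identities\<close>

lemma norm_Ints_ge_1:
  fixes z :: complex
  assumes "z \<in> \<int>" "z \<noteq> 0"
  shows "1 \<le> norm z"
  using assms by (auto elim!: Ints_cases)

text \<open>Logarithmic differentiation: the factor \<open>1 - x i * X\<close> contributes
  \<open>- x i / (1 - x i * X)\<close>, whose geometric expansion produces the power sums as
  coefficients.\<close>

lemma fps_deriv_prod_linear:
  fixes x :: "'i \<Rightarrow> complex"
  assumes "finite I"
  shows "fps_deriv (\<Prod>i\<in>I. 1 - fps_const (x i) * fps_X)
       = - (\<Prod>i\<in>I. 1 - fps_const (x i) * fps_X) * Abs_fps (\<lambda>l. \<Sum>i\<in>I. x i ^ Suc l)"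
  using assms
proof (induction I rule: finite_induct)
  case empty
  have "Abs_fps (\<lambda>l. 0) = (0 :: complex fps)" by (simp add: fps_eq_iff)
  then show ?case by simp
next
  case (insert a I)
  define G where "G = (\<Prod>i\<in>I. 1 - fps_const (x i) * fps_X)"
  define S where "S = Abs_fps (\<lambda>l. \<Sum>i\<in>I. x i ^ Suc l)"
  define T where "T = Abs_fps (\<lambda>l. x a ^ Suc l)"
  have T: "(1 - fps_const (x a) * fps_X) * T = fps_const (x a)"
  proof (rule fps_ext)
    fix n
    show "fps_nth ((1 - fps_const (x a) * fps_X) * T) n = fps_nth (fps_const (x a)) n"
      by (cases n) (simp_all add: T_def algebra_simps fps_X_mult_nth)
  qed
  have "Abs_fps (\<lambda>l. \<Sum>i\<in>insert a I. x i ^ Suc l) = T + S"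
    using insert.hyps by (simp add: fps_eq_iff T_def S_def)
  moreover have "fps_deriv ((1 - fps_const (x a) * fps_X) * G)
      = - ((1 - fps_const (x a) * fps_X) * G) * (T + S)"
  proof -
    have "fps_deriv ((1 - fps_const (x a) * fps_X) * G)
        = (1 - fps_const (x a) * fps_X) * (- G * S) - fps_const (x a) * G"
      using insert.IH by (simp add: G_def S_def flip: fps_const_neg)
    also have "\<dots> = - ((1 - fps_const (x a) * fps_X) * G) * (T + S)"
    proof -
      have "L * (- G * S) - U * G = - (L * G) * (T + S)" if "L * T = U" for L U :: "complex fps"
        using that by (auto simp: algebra_simps)
      from this[OF T] show ?thesis .
    qed
    finally show ?thesis .
  qed
  ultimately show ?case
    using insert.hyps by (simp add: G_def)
qed

text \<open>Compares coefficients in \<open>fps_deriv_prod_linear\<close>. Factors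
  \<open>1 - x i * X\<close> instead of \<open>X - x i\<close> give \<open>c 0 = 1\<close> and an
  identity that does not mention \<open>card I\<close>.\<close>

lemma newton_identity:
  fixes x :: "'i \<Rightarrow> complex"
  assumes "finite I"
  defines "c \<equiv> coeff (\<Prod>i\<in>I. [:1, - x i:])"
  shows "of_nat (Suc n) * c (Suc n) = - (\<Sum>k\<le>n. c k * (\<Sum>i\<in>I. x i ^ Suc (n - k)))"
proof -
  define F where "F = (\<Prod>i\<in>I. 1 - fps_const (x i) * fps_X)"
  have F: "F = fps_of_poly (\<Prod>i\<in>I. [:1, - x i:])"
    by (simp add: F_def fps_of_poly_prod fps_of_poly_linear' flip: fps_const_neg)
  have "fps_nth (fps_deriv F) n = fps_nth (- F * Abs_fps (\<lambda>l. \<Sum>i\<in>I. x i ^ Suc l)) n"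
    using fps_deriv_prod_linear[OF assms(1), of x] by (simp add: F_def)
  then show ?thesis
    by (simp add: F fps_mult_nth c_def atMost_atLeast0 add.commute)
qed

text \<open>Since \<open>c 0 = 1\<close>, each Newton identity can be solved for its highest power
  sum without division, so integrality passes from coefficients to power sums.\<close>

lemma power_sums_in_Ints:
  fixes x :: "'i \<Rightarrow> complex"
  assumes I: "finite I" and c: "\<And>n. coeff (\<Prod>i\<in>I. [:1, - x i:]) n \<in> \<int>"
  shows "(\<Sum>i\<in>I. x i ^ l) \<in> \<int>"
proof (cases l)
  case (Suc n)
  have "(\<Sum>i\<in>I. x i ^ Suc n) \<in> \<int>"
  proof (induction n rule: less_induct)
    case (less n)
    let ?c = "coeff (\<Prod>i\<in>I. [:1, - x i:])"
    have c0: "?c 0 = 1"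
      by (simp flip: poly_0_coeff_0 add: poly_prod)
    have "{..n} = insert 0 {1..n}" by auto
    then have split: "(\<Sum>k\<le>n. ?c k * (\<Sum>i\<in>I. x i ^ Suc (n - k)))
        = (\<Sum>i\<in>I. x i ^ Suc n) + (\<Sum>k=1..n. ?c k * (\<Sum>i\<in>I. x i ^ Suc (n - k)))"
      by (simp add: c0)
    have "(\<Sum>i\<in>I. x i ^ Suc n)
        = - of_nat (Suc n) * ?c (Suc n) - (\<Sum>k=1..n. ?c k * (\<Sum>i\<in>I. x i ^ Suc (n - k)))"
      using newton_identity[OF I, of n x] unfolding split by algebra
    moreover have "(\<Sum>k=1..n. ?c k * (\<Sum>i\<in>I. x i ^ Suc (n - k))) \<in> \<int>"
      by (intro Ints_sum Ints_mult c less.IH) auto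
    moreover have "- of_nat (Suc n) * ?c (Suc n) \<in> \<int>"
      by (intro Ints_mult c Ints_minus Ints_of_nat)
    ultimately show ?case by (simp only: Ints_diff)
  qed
  with Suc show ?thesis by simp
qed simp

text \<open>In this direction isolating the \<open>n\<close>-th coefficient costs a division by
  \<open>n\<close>; the factorial collects these divisors.\<close>

lemma fact_times_coeff_in_Ints:
  fixes x :: "'i \<Rightarrow> complex"
  assumes I: "finite I" and p: "\<And>l. (\<Sum>i\<in>I. x i ^ Suc l) \<in> \<int>"
  shows "fact n * coeff (\<Prod>i\<in>I. [:1, - x i:]) n \<in> \<int>"
proof (induction n rule: less_induct)
  case (less n)
  let ?c = "coeff (\<Prod>i\<in>I. [:1, - x i:])"
  show ?case
  proof (cases n)
    case 0
    then show ?thesis by (simp flip: poly_0_coeff_0 add: poly_prod)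
  next
    case (Suc m)
    have "fact n * ?c n = fact m * (of_nat (Suc m) * ?c (Suc m))"
      by (simp add: Suc algebra_simps)
    also have "\<dots> = - (\<Sum>k\<le>m. (fact m * ?c k) * (\<Sum>i\<in>I. x i ^ Suc (m - k)))"
      by (subst newton_identity[OF I]) (simp add: sum_distrib_left mult.assoc)
    also have "\<dots> \<in> \<int>"
    proof (intro Ints_minus Ints_sum Ints_mult[OF _ p])
      fix k assume "k \<in> {..m}"
      then have "fact k dvd (fact m :: nat)" by (simp add: fact_dvd)
      then obtain r :: nat where "fact m = fact k * r" by (elim dvdE)
      then have r: "(fact m :: complex) = of_nat r * fact k"
        by (metis mult.commute of_nat_fact of_nat_mult)
      have "fact k * ?c k \<in> \<int>"
        using \<open>k \<in> {..m}\<close> Suc by (intro less.IH) auto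
      moreover have "fact m * ?c k = of_nat r * (fact k * ?c k)"
        by (simp add: r)
      ultimately show "fact m * ?c k \<in> \<int>"
        by (metis Ints_mult Ints_of_nat)
    qed
    finally show ?thesis .
  qed
qed

lemma coeff_card_prod_linear:
  fixes x :: "'i \<Rightarrow> complex"
  assumes "finite I"
  shows "coeff (\<Prod>i\<in>I. [:1, - x i:]) (card I) = (\<Prod>i\<in>I. - x i)"
proof -
  \<comment> \<open>The degree bound joins the induction because the new top coefficient contains
    \<open>coeff F (Suc (card I))\<close>, which must vanish.\<close>
  have "coeff (\<Prod>i\<in>I. [:1, - x i:]) (card I) = (\<Prod>i\<in>I. - x i) \<and>
      degree (\<Prod>i\<in>I. [:1, - x i:]) \<le> card I"
    using assms
  proof (induction I rule: finite_induct)
    case (insert a I)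
    define F where "F = (\<Prod>i\<in>I. [:1, - x i:])"
    have "coeff F (Suc (card I)) = 0"
      using insert.IH by (intro coeff_eq_0) (auto simp: F_def)
    moreover have "degree ([:1, - x a:] * F) \<le> 1 + card I"
      using insert.IH by (intro order.trans[OF degree_mult_le] add_mono) (auto simp: F_def)
    ultimately show ?case
      using insert by (simp flip: F_def)
  qed simp
  then show ?thesis ..
qed

lemma coeff_prod_linear_scaled:
  fixes x :: "'i \<Rightarrow> complex"
  assumes "finite I"
  shows "coeff (\<Prod>i\<in>I. [:1, - (a * x i):]) n = a ^ n * coeff (\<Prod>i\<in>I. [:1, - x i:]) n"
  using assms
proof (induction I arbitrary: n rule: finite_induct)
  case empty
  then show ?case by (cases n) (auto simp: coeff_1)
next
  case (insert b I)
  then show ?case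
    by (cases n) (simp_all add: algebra_simps)
qed

text \<open>Applied to the powers \<open>x i ^ t\<close>, Newton's identities bound the \<open>t\<close>-th power of
  the product from below by \<open>1 / fact k\<close>, with \<open>k\<close> independent of \<open>t\<close>; letting \<open>t\<close> grow
  removes this loss, and integrality of the \<open>x i\<close> is never needed.\<close>
lemma norm_prod_ge_1_if_power_sums_in_Ints:
  fixes x :: "'i \<Rightarrow> complex"
  assumes I: "finite I" and p: "\<And>l. (\<Sum>i\<in>I. x i ^ Suc l) \<in> \<int>"
  shows "1 \<le> (\<Prod>i\<in>{i\<in>I. x i \<noteq> 0}. norm (x i))"
proof (rule ccontr)
  define J where "J = {i\<in>I. x i \<noteq> 0}"
  define y where "y = (\<Prod>i\<in>J. norm (x i))"
  assume "\<not> ?thesis"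
  then have y: "0 \<le> y" "y < 1" by (auto simp: y_def J_def intro: prod_nonneg)
  have J: "finite J" using I by (simp add: J_def)
  have ge: "1 \<le> fact (card J) * y ^ Suc t" for t
  proof -
    let ?z = "\<lambda>i. x i ^ Suc t"
    have "(\<Sum>i\<in>J. ?z i ^ Suc l) \<in> \<int>" for l
    proof -
      \<comment> \<open>The exponent \<open>Suc t * Suc l\<close> is positive, so the zero terms
        left out of \<open>J\<close> contribute nothing.\<close>
      have "(\<Sum>i\<in>J. ?z i ^ Suc l) = (\<Sum>i\<in>I. x i ^ Suc (t + (l + t * l)))"
        using I by (intro sum.mono_neutral_cong_left)
          (auto simp: J_def simp flip: power_mult power_add power_Suc)
      then show ?thesis using p by metis
    qed
    from fact_times_coeff_in_Ints[OF J this, of "card J"]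
    have int: "fact (card J) * (\<Prod>i\<in>J. - ?z i) \<in> \<int>"
      by (simp only: coeff_card_prod_linear[OF J])
    moreover have "fact (card J) * (\<Prod>i\<in>J. - ?z i) \<noteq> 0"
      using J by (auto simp: J_def)
    ultimately have "1 \<le> norm (fact (card J) * (\<Prod>i\<in>J. - ?z i))"
      by (rule norm_Ints_ge_1)
    also have "\<dots> = fact (card J) * y ^ Suc t"
      by (simp only: norm_mult norm_fact prod_norm[symmetric] norm_minus_cancel norm_power y_def prod_power_distrib)
    finally show ?thesis .
  qed
  have "(\<lambda>t. fact (card J) * y ^ Suc t) \<longlonglongrightarrow> fact (card J) * 0"
    using y by (intro tendsto_mult tendsto_const LIMSEQ_Suc LIMSEQ_power_zero) auto
  then have "1 \<le> fact (card J) * (0 :: real)"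
    by (rule LIMSEQ_le_const) (use ge in blast)
  then show False by simp
qed

subsection \<open>Integral polynomial functions of conjugates\<close>

text \<open>Models integer polynomials in the numbers \<open>x i (\<kappa> i)\<close>, seen as
  functions of a choice \<open>\<kappa>\<close> of one value per index. Differences of monomials
  already generate zero, negation and addition.\<close>

inductive_set int_poly_funs :: "('i \<Rightarrow> 'k \<Rightarrow> complex) \<Rightarrow> 'i set \<Rightarrow> (('i \<Rightarrow> 'k) \<Rightarrow> complex) set"
  for x J where
  monom: "(\<lambda>\<kappa>. \<Prod>i\<in>J. x i (\<kappa> i) ^ a i) \<in> int_poly_funs x J"
| diff: "f \<in> int_poly_funs x J \<Longrightarrow> g \<in> int_poly_funs x J \<Longrightarrow> (\<lambda>\<kappa>. f \<kappa> - g \<kappa>) \<in> int_poly_funs x J"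

lemma int_poly_funs_0: "(\<lambda>_. 0) \<in> int_poly_funs x J"
proof -
  have "(\<lambda>\<kappa>. \<Prod>i\<in>J. x i (\<kappa> i) ^ 0) \<in> int_poly_funs x J" by (rule int_poly_funs.monom)
  from int_poly_funs.diff[OF this this] show ?thesis by simp
qed

lemma int_poly_funs_1: "(\<lambda>_. 1) \<in> int_poly_funs x J"
  using int_poly_funs.monom[where x = x and J = J and a = "\<lambda>_. 0"] by simp

lemma int_poly_funs_add:
  assumes "f \<in> int_poly_funs x J" "g \<in> int_poly_funs x J"
  shows "(\<lambda>\<kappa>. f \<kappa> + g \<kappa>) \<in> int_poly_funs x J"
  using int_poly_funs.diff[OF assms(1) int_poly_funs.diff[OF int_poly_funs_0 assms(2)]] by simp

lemma int_poly_funs_sum: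
  assumes "\<And>a. a \<in> A \<Longrightarrow> f a \<in> int_poly_funs x J"
  shows "(\<lambda>\<kappa>. \<Sum>a\<in>A. f a \<kappa>) \<in> int_poly_funs x J"
  using assms
  by (induction A rule: infinite_finite_induct) (auto intro: int_poly_funs_0 int_poly_funs_add)

lemma int_poly_funs_mult:
  assumes "f \<in> int_poly_funs x J" "g \<in> int_poly_funs x J"
  shows "(\<lambda>\<kappa>. f \<kappa> * g \<kappa>) \<in> int_poly_funs x J"
  using assms(1)
proof induction
  case (monom a)
  show ?case using assms(2)
  proof induction
    case (monom b)
    show ?case
      using int_poly_funs.monom[where x = x and J = J and a = "\<lambda>i. a i + b i"] by (simp add: power_add prod.distrib)
  next
    case (diff f g)
    then show ?case using int_poly_funs.diff by (simp add: right_diff_distrib)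
  qed
next
  case (diff f g)
  then show ?case using int_poly_funs.diff by (simp add: left_diff_distrib)
qed

lemma int_poly_funs_power:
  assumes "f \<in> int_poly_funs x J"
  shows "(\<lambda>\<kappa>. f \<kappa> ^ n) \<in> int_poly_funs x J"
  by (induction n) (auto intro: int_poly_funs_1 int_poly_funs_mult assms)

lemma int_poly_funs_of_nat: "(\<lambda>_. of_nat n) \<in> int_poly_funs x J"
  by (induction n) (auto intro: int_poly_funs_0 int_poly_funs_1 int_poly_funs_add)

lemma int_poly_funs_prod:
  assumes "finite J" "L \<subseteq> J"
  shows "(\<lambda>\<kappa>. \<Prod>i\<in>L. x i (\<kappa> i)) \<in> int_poly_funs x J"
proof -
  have "(\<Prod>i\<in>J. x i (\<kappa> i) ^ (if i \<in> L then 1 else 0)) = (\<Prod>i\<in>L. x i (\<kappa> i))" for \<kappa>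
    using assms by (intro prod.mono_neutral_cong_right) auto
  then show ?thesis
    using int_poly_funs.monom[where x = x and J = J and a = "\<lambda>i. if i \<in> L then 1 else 0"] by simp
qed

text \<open>Summed over all choices, a monomial factors into a product of power sums, one per index.
  This serves as a substitute for the theorem on symmetric polynomials.\<close>

lemma sum_int_poly_funs_in_Ints:
  assumes "f \<in> int_poly_funs x J" "finite J" "\<And>i. i \<in> J \<Longrightarrow> finite (A i)"
    and "\<And>i l. i \<in> J \<Longrightarrow> (\<Sum>k\<in>A i. x i k ^ l) \<in> \<int>"
  shows "(\<Sum>\<kappa>\<in>PiE J A. f \<kappa>) \<in> \<int>"
  using assms(1)
proof induction
  case (monom a)
  have "(\<Sum>\<kappa>\<in>PiE J A. \<Prod>i\<in>J. x i (\<kappa> i) ^ a i) = (\<Prod>i\<in>J. \<Sum>k\<in>A i. x i k ^ a i)"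
    using assms(2,3) by (rule prod_sum_PiE[symmetric])
  then show ?case using assms(4) by auto
next
  case (diff f g)
  then show ?case by (simp add: sum_subtractf)
qed

subsection \<open>Minimal polynomials\<close>

text \<open>A nonzero rational polynomial of least degree vanishing at \<open>x\<close>, divided by
  its leading coefficient, is a witness for the choice operator in \<open>min_poly\<close>.\<close>

lemma min_poly_props:
  assumes "algebraic x"
  shows "rat_poly (min_poly x)" "lead_coeff (min_poly x) = 1" "poly (min_poly x) x = 0"
    "\<And>q. rat_poly q \<Longrightarrow> q \<noteq> 0 \<Longrightarrow> poly q x = 0 \<Longrightarrow> degree (min_poly x) \<le> degree q"
proof -
  define Q where "Q = (\<lambda>q. rat_poly q \<and> q \<noteq> 0 \<and> poly q x = 0)"
  have "\<exists>q. Q q"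
    using assms unfolding algebraic_altdef Q_def rat_poly_def by blast
  then obtain p where p: "Q p" "\<And>q. Q q \<Longrightarrow> degree p \<le> degree q"
    using ex_has_least_nat[of Q _ degree] by blast
  define p' where "p' = smult (inverse (lead_coeff p)) p"
  have "rat_poly p' \<and> lead_coeff p' = 1 \<and> poly p' x = 0 \<and>
      (\<forall>q. rat_poly q \<and> q \<noteq> 0 \<and> poly q x = 0 \<longrightarrow> degree p' \<le> degree q)"
    using p by (auto simp: Q_def p'_def rat_poly_def intro!: Rats_mult Rats_inverse)
  then have *: "rat_poly (min_poly x) \<and> lead_coeff (min_poly x) = 1 \<and> poly (min_poly x) x = 0 \<and>
      (\<forall>q. rat_poly q \<and> q \<noteq> 0 \<and> poly q x = 0 \<longrightarrow> degree (min_poly x) \<le> degree q)"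
    unfolding min_poly_def by (rule someI)
  then show "rat_poly (min_poly x)" "lead_coeff (min_poly x) = 1" "poly (min_poly x) x = 0"
    "\<And>q. rat_poly q \<Longrightarrow> q \<noteq> 0 \<Longrightarrow> poly q x = 0 \<Longrightarrow> degree (min_poly x) \<le> degree q"
    by blast+
qed

lemma degree_min_poly_pos:
  assumes "algebraic x"
  shows "0 < degree (min_poly x)"
proof (rule ccontr)
  assume "\<not> ?thesis"
  then obtain c where "min_poly x = [:c:]" by (auto elim: degree_eq_zeroE)
  then show False using min_poly_props[OF assms] by simp
qed

lemma rat_poly_clear_denominators:
  assumes "rat_poly p"
  obtains A where "0 < A" "\<And>i. of_nat A * coeff p i \<in> \<int>"
proof -
  have ex: "\<exists>b::nat. 0 < b \<and> of_nat b * z \<in> \<int>" if z: "z \<in> \<rat>" for z :: complex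
  proof -
    obtain a b where ab: "b > 0" "z = of_int a / of_int b"
      using z by (auto elim: Rats_cases')
    then have "of_nat (nat b) * z = of_int a" by (simp add: of_nat_nat)
    with ab(1) show ?thesis by (intro exI[of _ "nat b"]) simp
  qed
  then obtain b where b: "\<And>z :: complex. z \<in> \<rat> \<Longrightarrow> 0 < b z \<and> of_nat (b z) * z \<in> \<int>" by metis
  have rat: "coeff p i \<in> \<rat>" for i using assms by (simp add: rat_poly_def)
  define A where "A = (\<Prod>i\<le>degree p. b (coeff p i))"
  show ?thesis
  proof
    show "0 < A" using b rat by (auto simp: A_def intro!: prod_pos)
    fix i
    show "of_nat A * coeff p i \<in> \<int>"
    proof (cases "i \<le> degree p")
      case True
      then have "A = (\<Prod>j\<in>{..degree p} - {i}. b (coeff p j)) * b (coeff p i)"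
        unfolding A_def by (subst prod.remove[of _ i]) auto
      then have "of_nat A * coeff p i
          = of_nat (\<Prod>j\<in>{..degree p} - {i}. b (coeff p j)) * (of_nat (b (coeff p i)) * coeff p i)"
        by (simp only: of_nat_mult mult.assoc)
      also have "\<dots> \<in> \<int>" using b[OF rat[of i]] by (intro Ints_mult[OF Ints_of_nat, of "of_nat (b (coeff p i)) * coeff p i"]) blast
      finally show ?thesis .
    qed (simp add: coeff_eq_0)
  qed
qed

lemma map_poly_of_int_add:
  "map_poly of_int (p + q) = (map_poly of_int p + map_poly of_int q :: complex poly)"
  by (simp add: poly_eq_iff coeff_map_poly)

lemma map_poly_of_int_mult:
  "map_poly of_int (p * q) = (map_poly of_int p * map_poly of_int q :: complex poly)"
  by (simp add: poly_eq_iff coeff_map_poly coeff_mult)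

lemma map_poly_of_int_smult:
  "map_poly of_int (smult c p) = (smult (of_int c) (map_poly of_int p) :: complex poly)"
  by (simp add: poly_eq_iff coeff_map_poly)

text \<open>Gauss's lemma, with pseudo-division of a monic integral equation of \<open>x\<close> by the primitive
  integral multiple of the minimal polynomial.\<close>
lemma min_poly_coeff_in_Ints:
  assumes "algebraic_int x"
  shows "coeff (min_poly x) i \<in> \<int>"
proof -
  note mp = min_poly_props[OF algebraic_int_imp_algebraic[OF assms]]
  from assms obtain f where f: "poly (map_poly of_int f) x = 0" "lead_coeff f = 1"
    unfolding algebraic_int_altdef_ipoly by blast
  obtain A where A: "0 < A" "\<And>i. of_nat A * coeff (min_poly x) i \<in> \<int>"
    using rat_poly_clear_denominators[OF mp(1)] by blast
  obtain P0 :: "int poly" where P0: "smult (of_nat A) (min_poly x) = map_poly of_int P0"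
    by (rule intpolyE[of "smult (of_nat A) (min_poly x)"]) (use A in auto)
  define P where "P = primitive_part P0"
  have "P0 \<noteq> 0" using P0 A(1) mp(2) by auto
  then have P: "P \<noteq> 0" "content P = 1" "content P0 \<noteq> 0" by (auto simp: P_def)
  have "map_poly (of_int :: int \<Rightarrow> complex) (smult (content P0) P) = map_poly of_int P0"
    by (simp only: P_def content_times_primitive_part)
  then have eq: "smult (of_int (content P0)) (map_poly of_int P) = smult (of_nat A) (min_poly x)"
    by (simp add: P0 map_poly_of_int_smult)
  have degP: "degree P = degree (min_poly x)"
    using arg_cong[OF eq, of degree] A(1) P(3) by (simp add: degree_map_poly)
  obtain q r where qr: "pseudo_divmod f P = (q, r)" by fastforce
  note pd = pseudo_divmod[OF P(1) qr]
  define c where "c = coeff P (degree P) ^ (Suc (degree f) - degree P)"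
  have c: "c \<noteq> 0" using P(1) by (simp add: c_def)
  have fqr: "smult c f = P * q + r" using pd(1) by (simp add: c_def)
  have rootP: "poly (map_poly of_int P) x = 0"
    using arg_cong[OF eq, of "\<lambda>p. poly p x"] mp(3) P(3) by simp
  have hom: "map_poly of_int (P * q + r) =
      map_poly of_int P * map_poly of_int q + (map_poly of_int r :: complex poly)"
    by (simp only: map_poly_of_int_add map_poly_of_int_mult)
  have "poly (map_poly of_int r) x = 0"
    using arg_cong[OF fqr, of "\<lambda>p. poly (map_poly of_int p) x"] f(1) rootP
    by (simp add: hom map_poly_of_int_smult)
  have "r = 0"
  proof (rule ccontr)
    assume "r \<noteq> 0"
    then have "degree (min_poly x) \<le> degree (map_poly (of_int :: int \<Rightarrow> complex) r)"
      using \<open>poly (map_poly of_int r) x = 0\<close>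
      by (intro mp(4)) (auto simp: rat_poly_def coeff_map_poly poly_eq_iff)
    with pd(2) \<open>r \<noteq> 0\<close> degP show False by (simp add: degree_map_poly)
  qed
  with fqr have fq: "smult c f = P * q" by simp
  \<comment> \<open>As \<open>f\<close> is monic, its content is 1, and comparing contents gives
    \<open>q\<close> the content \<open>\<bar>c\<bar>\<close>. Cancelling \<open>c\<close> leaves
    \<open>lead_coeff P\<close> as a unit, so \<open>P\<close> is \<open>min_poly x\<close> up to
    sign.\<close>
  have "content f dvd lead_coeff f" by (rule content_dvd_coeff)
  with f(2) have "content f = 1" by (metis is_unit_content_iff)
  moreover have "content (smult c f) = content P * content q"
    by (simp only: fq content_mult)
  ultimately have "content q = \<bar>c\<bar>"
    using P(2) by simp
  then have "smult c f = P * smult \<bar>c\<bar> (primitive_part q)"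
    by (metis content_times_primitive_part fq)
  then have "c * lead_coeff f = \<bar>c\<bar> * (lead_coeff P * lead_coeff (primitive_part q))"
    by (metis (no_types, lifting) lead_coeff_mult lead_coeff_smult mult.left_commute)
  with f(2) c have "\<bar>lead_coeff P * lead_coeff (primitive_part q)\<bar> = 1"
    by (metis abs_idempotent abs_mult mult_cancel_left1)
  then have lcP: "\<bar>lead_coeff P\<bar> = 1" using abs_zmult_eq_1 by blast
  have "of_int (content P0) * of_int (lead_coeff P) = (of_nat A :: complex)"
    using arg_cong[OF eq, of "\<lambda>p. coeff p (degree P)"] mp(2) degP by (simp add: coeff_map_poly)
  then have "coeff (min_poly x) i = of_int (lead_coeff P) * of_int (coeff P i)"
  proof -
    assume h: "of_int (content P0) * of_int (lead_coeff P) = (of_nat A :: complex)"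
    have "of_int (content P0) * of_int (coeff P i) = of_nat A * coeff (min_poly x) i"
      using arg_cong[OF eq, of "\<lambda>p. coeff p i"] by (simp add: coeff_map_poly)
    then have "of_int (content P0) * of_int (coeff P i)
        = of_int (content P0) * (of_int (lead_coeff P) * coeff (min_poly x) i)"
      by (simp flip: h)
    with P(3) have k: "of_int (coeff P i) = of_int (lead_coeff P) * coeff (min_poly x) i" by simp
    have "of_int (lead_coeff P) * of_int (lead_coeff P) = (1 :: complex)"
      using lcP by (metis abs_mult_self_eq mult.right_neutral of_int_1 of_int_mult)
    then show ?thesis unfolding k by (simp flip: mult.assoc)
  qed
  then show ?thesis by simp
qed

text \<open>The roots of \<open>p\<close> are listed with multiplicity.\<close>
lemma monic_poly_roots:
  fixes p :: "complex poly"
  assumes "lead_coeff p = 1"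
  obtains r where "\<And>z. poly p z = 0 \<longleftrightarrow> z \<in> r ` {..<degree p}"
    "\<And>a l. (\<And>i. a ^ i * coeff (reflect_poly p) i \<in> \<int>) \<Longrightarrow> (\<Sum>k<degree p. (a * r k) ^ l) \<in> \<int>"
proof -
  obtain r where "smult (lead_coeff p) (\<Prod>i<degree p. [:- r i, 1:]) = p"
    using complex_poly_decompose' .
  with assms have p: "p = (\<Prod>i<degree p. [:- r i, 1:])" by simp
  \<comment> \<open>Reversal turns \<open>X - r i\<close> into \<open>1 - r i * X\<close>, the shape
    used in the Newton identities.\<close>
  have refl: "reflect_poly p = (\<Prod>i<degree p. [:1, - r i:])"
  proof -
    have "reflect_poly [:- z, 1:] = [:1, - z:]" for z :: complex
      by (auto simp: poly_eq_iff coeff_reflect_poly coeff_pCons split: nat.split)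
    then show ?thesis by (subst p) (simp add: reflect_poly_prod)
  qed
  show thesis
  proof
    show "poly p z = 0 \<longleftrightarrow> z \<in> r ` {..<degree p}" for z
      by (subst p) (auto simp: poly_prod)
    fix a l assume "\<And>i. a ^ i * coeff (reflect_poly p) i \<in> \<int>"
    then show "(\<Sum>k<degree p. (a * r k) ^ l) \<in> \<int>"
      by (intro power_sums_in_Ints) (auto simp: coeff_prod_linear_scaled simp flip: refl)
  qed
qed

subsection \<open>A Liouville-type lower bound\<close>

text \<open>\<open>C\<close> is fixed before \<open>N\<close>, \<open>\<alpha>\<close> and
  \<open>b\<close> because the growth argument uses it for all partial sums at once; the uniform
  bound \<open>\<sigma>\<close> on the sums of \<open>1 / b i\<close> makes this possible. The
  exponent \<open>D * d ^ N\<close> bounds the number of choices of conjugates.\<close>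

lemma liouville_lower_bound:
  fixes s :: complex and \<sigma> :: real
  assumes s: "algebraic s" "degree (min_poly s) \<le> D" and \<sigma>: "0 \<le> \<sigma>"
  obtains C :: real where "1 \<le> C"
    "\<And>N \<alpha> b. \<lbrakk>\<And>i. i \<in> {1..N} \<Longrightarrow> algebraic_int (\<alpha> i) \<and> degree (min_poly (\<alpha> i)) \<le> d \<and> \<alpha> i \<noteq> 0;
       \<And>i. i \<in> {1..N} \<Longrightarrow> 1 \<le> b i;
       \<And>i z. i \<in> {1..N} \<Longrightarrow> poly (min_poly (\<alpha> i)) z = 0 \<Longrightarrow> norm z \<le> b i;
       (\<Sum>i=1..N. 1 / b i) \<le> \<sigma>; s \<noteq> (\<Sum>i=1..N. 1 / \<alpha> i)\<rbrakk>
      \<Longrightarrow> 1 \<le> norm (s - (\<Sum>i=1..N. 1 / \<alpha> i)) * (C * (\<Prod>i=1..N. b i)) ^ (D * d ^ N)"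
proof -
  note mps = min_poly_props[OF s(1)]
  obtain A :: nat where A: "0 < A" "\<And>i. of_nat A * coeff (min_poly s) i \<in> \<int>"
    using rat_poly_clear_denominators[OF mps(1)] by blast
  let ?n = "degree (min_poly s)"
  obtain r0 where r0: "\<And>z. poly (min_poly s) z = 0 \<longleftrightarrow> z \<in> r0 ` {..<?n}"
    and r0_sums: "\<And>a l. (\<And>i. a ^ i * coeff (reflect_poly (min_poly s)) i \<in> \<int>) \<Longrightarrow>
        (\<Sum>k<?n. (a * r0 k) ^ l) \<in> \<int>"
    using monic_poly_roots[OF mps(2)] by blast
  \<comment> \<open>\<open>s\<close> may fail to be integral, but \<open>A\<close> times its
    conjugates have integral power sums: the leading coefficient 1 sits at \<open>i = 0\<close>, and
    for \<open>i > 0\<close> one factor of \<open>A ^ i\<close> clears the denominator.\<close>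
  have s_sums: "(\<Sum>k<?n. (of_nat A * r0 k) ^ l) \<in> \<int>" for l
  proof (rule r0_sums)
    fix i
    show "of_nat A ^ i * coeff (reflect_poly (min_poly s)) i \<in> \<int>"
    proof (cases i)
      case 0
      then show ?thesis using mps(2) by (simp add: coeff_reflect_poly)
    next
      case (Suc j)
      have "of_nat A * coeff (reflect_poly (min_poly s)) i \<in> \<int>"
        using A(2) by (auto simp: coeff_reflect_poly)
      then have "of_nat A ^ j * (of_nat A * coeff (reflect_poly (min_poly s)) i) \<in> \<int>"
        by (intro Ints_mult[OF Ints_power[OF Ints_of_nat]])
      then show ?thesis by (simp add: Suc mult.assoc mult.left_commute)
    qed
  qed
  define h where "h = (\<Sum>k<?n. norm (r0 k))"
  have h: "norm (r0 k) \<le> h" if "k < ?n" for k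
    unfolding h_def using that by (intro member_le_sum) auto
  have h0: "0 \<le> h" by (auto simp: h_def intro: sum_nonneg)
  \<comment> \<open>In the estimate of \<open>\<beta>\<close>, \<open>A * h\<close> controls the
    scaled conjugate of \<open>s\<close> and \<open>A * \<sigma>\<close> the sum over
    \<open>i\<close>; the added 1 ensures \<open>A \<le> C\<close> and
    \<open>1 \<le> C\<close>.\<close>
  define C where "C = real A * (h + \<sigma> + 1)"
  have "1 * 1 \<le> C" unfolding C_def
    by (rule mult_mono) (use A(1) h0 \<sigma> in auto)
  then have C1: "1 \<le> C" by simp
  moreover have "1 \<le> norm (s - (\<Sum>i=1..N. 1 / \<alpha> i)) * (C * (\<Prod>i=1..N. b i)) ^ (D * d ^ N)"
    if \<alpha>: "\<And>i. i \<in> {1..N} \<Longrightarrow> algebraic_int (\<alpha> i) \<and> degree (min_poly (\<alpha> i)) \<le> d \<and> \<alpha> i \<noteq> 0"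
      and b1: "\<And>i. i \<in> {1..N} \<Longrightarrow> 1 \<le> b i"
      and b: "\<And>i z. i \<in> {1..N} \<Longrightarrow> poly (min_poly (\<alpha> i)) z = 0 \<Longrightarrow> norm z \<le> b i"
      and b\<sigma>: "(\<Sum>i=1..N. 1 / b i) \<le> \<sigma>" and ne: "s \<noteq> (\<Sum>i=1..N. 1 / \<alpha> i)"
    for N \<alpha> and b :: "nat \<Rightarrow> real"
  proof -
    let ?m = "\<lambda>i. degree (min_poly (\<alpha> i))"
    define \<gamma> where "\<gamma> = s - (\<Sum>i=1..N. 1 / \<alpha> i)"
    define P where "P = (\<Prod>i=1..N. b i)"
    have P1: "1 \<le> P" unfolding P_def using b1 by (intro prod_ge_1) auto
    have "\<exists>r. (\<forall>z. poly (min_poly (\<alpha> i)) z = 0 \<longleftrightarrow> z \<in> r ` {..<?m i}) \<and>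
        (\<forall>l. (\<Sum>k<?m i. r k ^ l) \<in> \<int>)" if "i \<in> {1..N}" for i
    proof -
      have "lead_coeff (min_poly (\<alpha> i)) = 1"
        using \<alpha>[OF that] by (intro min_poly_props algebraic_int_imp_algebraic) auto
      then obtain r where r: "\<And>z. poly (min_poly (\<alpha> i)) z = 0 \<longleftrightarrow> z \<in> r ` {..<?m i}"
        and rs: "\<And>a l. (\<And>j. a ^ j * coeff (reflect_poly (min_poly (\<alpha> i))) j \<in> \<int>) \<Longrightarrow>
          (\<Sum>k<?m i. (a * r k) ^ l) \<in> \<int>"
        using monic_poly_roots by blast
      have "(\<Sum>k<?m i. (1 * r k) ^ l) \<in> \<int>" for l
        using min_poly_coeff_in_Ints \<alpha>[OF that] by (intro rs) (auto simp: coeff_reflect_poly)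
      with r show ?thesis by auto
    qed
    then obtain r where r: "\<And>i z. i \<in> {1..N} \<Longrightarrow> poly (min_poly (\<alpha> i)) z = 0 \<longleftrightarrow> z \<in> r i ` {..<?m i}"
      and r_sums: "\<And>i l. i \<in> {1..N} \<Longrightarrow> (\<Sum>k<?m i. r i k ^ l) \<in> \<int>"
      by metis
    \<comment> \<open>Index 0 carries the conjugates of \<open>s\<close>, scaled by
      \<open>A\<close>; the indices from 1 to \<open>N\<close> carry those of the
      \<open>\<alpha> i\<close>.\<close>
    define x where "x = (\<lambda>i k. if i = 0 then of_nat A * r0 k else r i k)"
    define I where "I = (\<lambda>i. if i = 0 then {..<?n} else {..<?m i})"
    define K where "K = PiE {0..N} I"
    \<comment> \<open>This is \<open>\<gamma>\<close> multiplied by \<open>A\<close> and by all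
      \<open>\<alpha> i\<close> to remove denominators, with each number replaced by the conjugate
      that \<open>\<kappa>\<close> selects.\<close>
    define \<beta> where "\<beta> = (\<lambda>\<kappa>. (\<Prod>i\<in>{0..N}. x i (\<kappa> i))
        - of_nat A * (\<Sum>i=1..N. \<Prod>l\<in>{1..N}-{i}. x l (\<kappa> l)))"
    have set_0N: "{0..N} = insert 0 {1..N}" by auto
    have fin: "finite K" by (auto simp: K_def I_def intro!: finite_PiE)

    have "\<beta> \<in> int_poly_funs x {0..N}"
      unfolding \<beta>_def
      by (intro int_poly_funs.diff int_poly_funs_mult int_poly_funs_sum int_poly_funs_prod
          int_poly_funs_of_nat) auto
    then have "(\<Sum>\<kappa>\<in>K. \<beta> \<kappa> ^ Suc l) \<in> \<int>" for l
      unfolding K_def using s_sums r_sums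
      by (intro sum_int_poly_funs_in_Ints int_poly_funs_power) (auto simp: x_def I_def)
    then have ge1: "1 \<le> (\<Prod>\<kappa>\<in>{\<kappa>\<in>K. \<beta> \<kappa> \<noteq> 0}. norm (\<beta> \<kappa>))"
      by (rule norm_prod_ge_1_if_power_sums_in_Ints[OF fin])

    have x_le: "norm (x i (\<kappa> i)) \<le> b i" if "\<kappa> \<in> K" "i \<in> {1..N}" for \<kappa> i
    proof -
      from that(1) have "\<kappa> i \<in> I i"
        using that(2) unfolding K_def by (elim PiE_mem) auto
      with that(2) show ?thesis
        using r[OF that(2)] by (intro b) (auto simp: I_def x_def)
    qed
    have \<beta>_le: "norm (\<beta> \<kappa>) \<le> C * P" if \<kappa>: "\<kappa> \<in> K" for \<kappa>
    proof -
      have "norm (\<beta> \<kappa>) \<le> norm (\<Prod>i\<in>{0..N}. x i (\<kappa> i))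
          + norm (of_nat A * (\<Sum>i=1..N. \<Prod>l\<in>{1..N}-{i}. x l (\<kappa> l)))"
        unfolding \<beta>_def by (rule norm_triangle_ineq4)
      also have "norm (\<Prod>i\<in>{0..N}. x i (\<kappa> i)) \<le> (real A * h) * P"
      proof -
        have "\<kappa> 0 \<in> I 0" using \<kappa> unfolding K_def by (elim PiE_mem) auto
        then have "norm (x 0 (\<kappa> 0)) \<le> real A * h"
          using h by (auto simp: x_def I_def norm_mult intro: mult_left_mono)
        moreover have "(\<Prod>i\<in>{1..N}. norm (x i (\<kappa> i))) \<le> P"
          unfolding P_def using x_le[OF \<kappa>] by (intro prod_mono) auto
        ultimately show ?thesis
          unfolding set_0N prod_norm[symmetric]
          by (subst prod.insert) (auto intro!: mult_mono prod_nonneg simp: h0)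
      qed
      also have "norm (of_nat A * (\<Sum>i=1..N. \<Prod>l\<in>{1..N}-{i}. x l (\<kappa> l))) \<le> real A * (\<sigma> * P)"
      proof -
        have "norm (\<Sum>i=1..N. \<Prod>l\<in>{1..N}-{i}. x l (\<kappa> l))
            \<le> (\<Sum>i=1..N. norm (\<Prod>l\<in>{1..N}-{i}. x l (\<kappa> l)))"
          by (rule norm_sum)
        also have "\<dots> \<le> (\<Sum>i=1..N. P * (1 / b i))"
        proof (rule sum_mono)
          fix i assume i: "i \<in> {1..N}"
          have "norm (\<Prod>l\<in>{1..N}-{i}. x l (\<kappa> l)) \<le> (\<Prod>l\<in>{1..N}-{i}. b l)"
            unfolding prod_norm[symmetric] using x_le[OF \<kappa>] by (intro prod_mono) auto
          also have "\<dots> = P * (1 / b i)"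
            unfolding P_def using i b1[OF i] by (subst prod.remove[of _ i]) auto
          finally show "norm (\<Prod>l\<in>{1..N}-{i}. x l (\<kappa> l)) \<le> P * (1 / b i)" .
        qed
        also have "\<dots> = P * (\<Sum>i=1..N. 1 / b i)" by (simp only: sum_distrib_left)
        also have "\<dots> \<le> P * \<sigma>" using b\<sigma> P1 by (intro mult_left_mono) auto
        finally show ?thesis by (simp add: norm_mult mult.commute mult_left_mono)
      qed
      also have "real A * h * P + real A * (\<sigma> * P) \<le> C * P"
        using P1 by (simp add: C_def algebra_simps)
      finally show ?thesis by simp
    qed

    \<comment> \<open>The choice built here selects \<open>s\<close> and the
      \<open>\<alpha> i\<close> themselves, so its \<open>\<beta>\<close> value contains the factor
      \<open>\<gamma>\<close>.\<close>
    obtain k0 where k0: "k0 < ?n" "r0 k0 = s" using r0[of s] mps(3) by auto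
    have "\<exists>k<?m i. r i k = \<alpha> i" if "i \<in> {1..N}" for i
      using r[OF that, of "\<alpha> i"] min_poly_props(3) \<alpha>[OF that] by auto
    then obtain k where k: "\<And>i. i \<in> {1..N} \<Longrightarrow> k i < ?m i \<and> r i (k i) = \<alpha> i" by metis
    define \<kappa> where "\<kappa> = restrict (\<lambda>i. if i = 0 then k0 else k i) {0..N}"
    have \<kappa>K: "\<kappa> \<in> K" using k0 k by (auto simp: K_def \<kappa>_def I_def)
    have x0: "x 0 (\<kappa> 0) = of_nat A * s" using k0 by (simp add: x_def \<kappa>_def)
    have xi: "x i (\<kappa> i) = \<alpha> i" if "i \<in> {1..N}" for i
      using k[OF that] that by (auto simp: x_def \<kappa>_def)
    have \<beta>\<kappa>: "\<beta> \<kappa> = of_nat A * (\<Prod>i=1..N. \<alpha> i) * \<gamma>"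
    proof -
      have "(\<Prod>l\<in>{1..N}-{i}. x l (\<kappa> l)) = (\<Prod>i=1..N. \<alpha> i) * (1 / \<alpha> i)" if i: "i \<in> {1..N}" for i
      proof -
        have "(\<Prod>l\<in>{1..N}-{i}. x l (\<kappa> l)) = (\<Prod>l\<in>{1..N}-{i}. \<alpha> l)"
          by (intro prod.cong) (auto simp: xi)
        then show ?thesis using i \<alpha>[OF i] by (subst prod.remove[of _ i]) auto
      qed
      moreover have "(\<Prod>i\<in>{0..N}. x i (\<kappa> i)) = of_nat A * s * (\<Prod>i=1..N. \<alpha> i)"
        unfolding set_0N by (subst prod.insert) (auto simp: x0 xi)
      ultimately show ?thesis
        by (simp add: \<beta>_def \<gamma>_def algebra_simps sum_distrib_left)
    qed
    have "\<beta> \<kappa> \<noteq> 0" unfolding \<beta>\<kappa> using A(1) \<alpha> ne by (auto simp: \<gamma>_def)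
    have \<beta>\<kappa>_le: "norm (\<beta> \<kappa>) \<le> norm \<gamma> * (C * P)"
    proof -
      have "norm (\<alpha> i) \<le> b i" if "i \<in> {1..N}" for i
        using x_le[OF \<kappa>K that] xi[OF that] by simp
      then have "(\<Prod>i=1..N. norm (\<alpha> i)) \<le> P"
        unfolding P_def by (intro prod_mono) auto
      then have "real A * (\<Prod>i=1..N. norm (\<alpha> i)) \<le> C * P"
        unfolding C_def using A(1) h0 \<sigma> by (intro mult_mono prod_nonneg) auto
      then show ?thesis
        by (simp add: \<beta>\<kappa> norm_mult prod_norm mult.commute[of "norm \<gamma>"] mult_right_mono)
    qed

    define Z where "Z = {\<kappa>\<in>K. \<beta> \<kappa> \<noteq> 0}"
    have Z: "finite Z" "\<kappa> \<in> Z" using fin \<kappa>K \<open>\<beta> \<kappa> \<noteq> 0\<close> by (auto simp: Z_def)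
    have CP: "1 \<le> C * P" using mult_mono[OF C1 P1] C1 by simp
    have "card Z \<le> card K" unfolding Z_def using fin by (intro card_mono) auto
    also have "card K = ?n * (\<Prod>i\<in>{1..N}. ?m i)"
      unfolding K_def by (subst card_PiE) (simp_all add: set_0N I_def)
    also have "\<dots> \<le> D * (\<Prod>i\<in>{1..N}. d)"
      using s(2) \<alpha> by (intro mult_mono prod_mono) auto
    finally have card: "card Z \<le> D * d ^ N" by simp
    \<comment> \<open>The factor at \<open>\<kappa>\<close> keeps \<open>norm \<gamma>\<close>;
      every other one is at most \<open>C * P\<close>. As \<open>1 \<le> C * P\<close>, the number
      of factors may be raised to \<open>D * d ^ N\<close>.\<close>
    have "1 \<le> (\<Prod>\<kappa>\<in>Z. norm (\<beta> \<kappa>))" using ge1 by (simp add: Z_def)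
    also have "\<dots> = norm (\<beta> \<kappa>) * (\<Prod>\<kappa>\<in>Z - {\<kappa>}. norm (\<beta> \<kappa>))"
      using Z by (rule prod.remove)
    also have "\<dots> \<le> (norm \<gamma> * (C * P)) * (\<Prod>\<kappa>\<in>Z - {\<kappa>}. C * P)"
      using \<beta>\<kappa>_le \<beta>_le CP
      by (intro mult_mono prod_mono) (auto simp: Z_def intro: prod_nonneg)
    also have "\<dots> = norm \<gamma> * (C * P) ^ card Z"
      using card_Suc_Diff1[OF Z] by (simp add: mult.assoc flip: power_Suc)
    also have "\<dots> \<le> norm \<gamma> * (C * P) ^ (D * d ^ N)"
      using CP card by (intro mult_left_mono power_increasing) auto
    finally show ?thesis by (simp add: \<gamma>_def P_def)
  qed
  ultimately show thesis by (rule that)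
qed

subsection \<open>Growth of the terms\<close>

text \<open>The reciprocal of the exponent in the limsup condition.\<close>

definition erdos_exponent :: "nat \<Rightarrow> nat \<Rightarrow> nat \<Rightarrow> real" where
  "erdos_exponent D d n = real D ^ n * (\<Prod>i=1..<n. real d ^ i + real d)"

lemma erdos_exponent_pos:
  assumes "0 < D" "0 < d"
  shows "0 < erdos_exponent D d n"
  using assms unfolding erdos_exponent_def
  by (intro mult_pos_pos prod_pos) (auto intro: add_pos_pos)

lemma erdos_exponent_Suc:
  assumes "1 \<le> n"
  shows "erdos_exponent D d (Suc n) = erdos_exponent D d n * (real D * (real d ^ n + real d))"
  using assms by (simp add: erdos_exponent_def prod.atLeastLessThan_Suc algebra_simps)

text \<open>The summand \<open>d\<close> in each factor of the exponent enters only through \<open>1 \<le> D * d\<close>.\<close>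
lemma erdos_exponent_add_ge:
  assumes "0 < D" "0 < d" "1 \<le> n"
  shows "erdos_exponent D d n * (1 + real (D * d ^ n)) ^ j \<le> erdos_exponent D d (n + j)"
proof (induction j)
  case (Suc j)
  have "1 + D * d ^ n \<le> D * d + D * d ^ (n + j)"
    using assms by (intro add_mono mult_mono power_increasing) auto
  then have "1 + real (D * d ^ n) \<le> real D * (real d ^ (n + j) + real d)"
    unfolding of_nat_le_iff[where 'a = real, symmetric] by (simp add: algebra_simps)
  then have "erdos_exponent D d n * (1 + real (D * d ^ n)) ^ j * (1 + real (D * d ^ n))
      \<le> erdos_exponent D d (n + j) * (real D * (real d ^ (n + j) + real d))"
    using Suc erdos_exponent_pos[OF assms(1,2)] by (intro mult_mono) (auto simp: less_imp_le)
  also have "\<dots> = erdos_exponent D d (Suc (n + j))"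
    using assms by (simp add: erdos_exponent_Suc)
  finally show ?case by (simp add: algebra_simps)
qed simp

lemma erdos_exponent_mono:
  assumes "0 < D" "0 < d" "1 \<le> m" "m \<le> n"
  shows "erdos_exponent D d m \<le> erdos_exponent D d n"
proof -
  have "erdos_exponent D d m * 1 \<le> erdos_exponent D d m * (1 + real (D * d ^ m)) ^ (n - m)"
    using erdos_exponent_pos[OF assms(1,2)] by (intro mult_left_mono one_le_power) (auto simp: less_imp_le)
  also have "\<dots> \<le> erdos_exponent D d (m + (n - m))"
    using assms by (intro erdos_exponent_add_ge) auto
  finally show ?thesis using assms by simp
qed

text \<open>Used to absorb \<open>j * ln j\<close>; the subtracted 1 lets the bound be measured by
  \<open>R - 1\<close> in \<open>ln_product_step\<close>.\<close>

lemma square_le_two_power: "(real j)\<^sup>2 \<le> 2 * (2 ^ j - 1)"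
proof (induction j)
  case (Suc j)
  have "real j + 1 \<le> 2 ^ j" by (induction j) auto
  with Suc show ?case by (simp add: power2_eq_square algebra_simps)
qed simp

text \<open>Here \<open>p\<close> stands for the sum of logarithms up to \<open>n\<close>, followed
  by \<open>j\<close> terms with one common bound. The constant added on both sides turns additive
  errors into multiples of \<open>R - 1\<close>: Bernoulli's inequality handles \<open>c\<close> and
  \<open>c'\<close>, and the quadratic bound on \<open>j * ln j\<close> accounts for
  \<open>2 * (1 + \<eta>)\<close>.\<close>

lemma ln_product_step:
  fixes b :: "nat \<Rightarrow> real" and K p c c' \<eta> R :: real
  assumes "1 \<le> K" "0 \<le> p" "0 \<le> c" "0 \<le> c'" "0 \<le> \<eta>" "1 \<le> j" "(1 + K) ^ j \<le> R"
  shows "p + real j * (K * (c + p) + c' + (1 + \<eta>) * ln (real j)) + (c + c' + 2 * (1 + \<eta>))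
    \<le> R * (p + (c + c' + 2 * (1 + \<eta>)))"
proof -
  have bern: "1 + real j * K \<le> (1 + K) ^ j"
    using Bernoulli_inequality[of K j] assms by (simp add: mult.commute)
  have "real j \<le> real j * K" using assms by (simp add: mult_le_cancel_left1)
  have "real j * ln (real j) \<le> (real j)\<^sup>2"
    using assms ln_le_minus_one[of "real j"]
    by (auto simp: power2_eq_square intro!: mult_left_mono)
  also have "\<dots> \<le> 2 * (2 ^ j - 1)" by (rule square_le_two_power)
  also have "(2 :: real) ^ j \<le> (1 + K) ^ j" using assms by (intro power_mono) auto
  finally have jl: "real j * ln (real j) \<le> 2 * (R - 1)" using assms by simp
  have 1: "p * (1 + real j * K) \<le> p * R" using assms bern by (intro mult_left_mono) auto
  have 2: "c * (real j * K) \<le> c * (R - 1)" using assms bern by (intro mult_left_mono) auto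
  have 3: "c' * real j \<le> c' * (R - 1)"
    using assms(4,7) bern \<open>real j \<le> real j * K\<close> by (intro mult_left_mono) linarith+
  have 4: "(1 + \<eta>) * (real j * ln (real j)) \<le> (1 + \<eta>) * (2 * (R - 1))"
    using assms jl by (intro mult_left_mono) auto
  show ?thesis using 1 2 3 4 by (simp add: algebra_simps)
qed

text \<open>\<open>step\<close> bounds \<open>b (n + j)\<close> for a single \<open>j\<close>, but by monotonicity this bounds the whole block
  from \<open>n\<close> to \<open>n + j\<close>; the proof jumps from block to block.\<close>
lemma ln_le_erdos_exponent:
  fixes b :: "nat \<Rightarrow> real" and c c' \<eta> :: real
  assumes D: "0 < D" and d: "0 < d" and n0: "1 \<le> n0"
    and b1: "\<And>i. 1 \<le> i \<Longrightarrow> 1 \<le> b i" and mono: "\<And>i j. 1 \<le> i \<Longrightarrow> i \<le> j \<Longrightarrow> b i \<le> b j"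
    and c: "0 \<le> c" and c': "0 \<le> c'" and \<eta>: "0 < \<eta>"
    and step: "\<And>n. n0 \<le> n \<Longrightarrow> \<exists>j\<ge>1.
      ln (b (n + j)) \<le> real (D * d ^ n) * (c + (\<Sum>i=1..n. ln (b i))) + c' + (1 + \<eta>) * ln (real j) \<and>
      \<eta> * ln (real j) \<le> real (D * d ^ n) * (c + (\<Sum>i=1..n. ln (b i))) + c'"
  obtains V where "\<And>m. n0 < m \<Longrightarrow> ln (b m) \<le> V * erdos_exponent D d m"
proof -
  define p where "p = (\<lambda>n. \<Sum>i=1..n. ln (b i))"
  define K where "K = (\<lambda>n. real (D * d ^ n))"
  define E where "E = (\<lambda>n. K n * (c + p n) + c')"
  define c2 where "c2 = c + c' + 2 * (1 + \<eta>)"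
  define T where "T = erdos_exponent D d"
  \<comment> \<open>Chosen so that the invariant \<open>p n + c2 \<le> W * T n\<close> is an
    equality at \<open>n = n0\<close>.\<close>
  define W where "W = (p n0 + c2) / T n0"
  define P where "P = (\<lambda>n j. ln (b (n + j)) \<le> E n + (1 + \<eta>) * ln (real j) \<and> \<eta> * ln (real j) \<le> E n)"
  have step': "\<exists>j\<ge>1. P n j" if "n0 \<le> n" for n
    using step[OF that] by (simp add: P_def E_def K_def p_def)
  have T: "0 < T n" for n using erdos_exponent_pos[OF D d] by (simp add: T_def)
  have K1: "1 \<le> K n" for n
  proof -
    have "1 \<le> D * d ^ n" using D d by simp
    then show ?thesis unfolding K_def by linarith
  qed
  have p0: "0 \<le> p n" for n using b1 by (auto simp: p_def intro!: sum_nonneg ln_ge_zero)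
  have c2: "0 \<le> c2" using c c' \<eta> by (simp add: c2_def)
  have advance: "p (n + j) + c2 \<le> W * T (n + j)"
    if "n0 \<le> n" "1 \<le> j" "P n j" "p n + c2 \<le> W * T n" for n j
  proof -
    have "p (n + j) = p n + (\<Sum>i=n+1..n+j. ln (b i))"
      unfolding p_def by (subst sum.ub_add_nat) auto
    also have "(\<Sum>i=n+1..n+j. ln (b i)) \<le> of_nat (card {n+1..n+j}) * ln (b (n + j))"
    proof (rule sum_bounded_above)
      fix i assume "i \<in> {n+1..n+j}"
      then show "ln (b i) \<le> ln (b (n + j))"
        using mono[of i "n + j"] b1[of i] by (intro ln_mono) auto
    qed
    also have "of_nat (card {n+1..n+j}) * ln (b (n + j)) \<le> real j * (E n + (1 + \<eta>) * ln (real j))"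
      using that(3) by (auto simp: P_def intro!: mult_left_mono)
    finally have "p (n + j) + c2 \<le> p n + real j * (K n * (c + p n) + c' + (1 + \<eta>) * ln (real j)) + c2"
      by (simp add: E_def)
    also have "\<dots> \<le> (T (n + j) / T n) * (p n + c2)"
      unfolding c2_def
    proof (rule ln_product_step)
      show "(1 + K n) ^ j \<le> T (n + j) / T n"
        using erdos_exponent_add_ge[OF D d, of n j] that(1) n0 T[of n]
        by (simp add: T_def K_def field_simps)
    qed (use K1 p0 c c' \<eta> that in auto)
    also have "\<dots> \<le> (T (n + j) / T n) * (W * T n)"
      using that(4) T by (intro mult_left_mono) (auto simp: less_imp_le)
    also have "\<dots> = W * T (n + j)" using T[of n] by simp
    finally show ?thesis .
  qed
  \<comment> \<open>Every \<open>m > n0\<close> lies in a block \<open>n < m \<le> n + j\<close>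
    whose start satisfies the invariant; once a block is exhausted, the next one starts at its
    end.\<close>
  have cover: "\<exists>n j. n0 \<le> n \<and> n < m \<and> m \<le> n + j \<and> P n j \<and> 1 \<le> j \<and> p n + c2 \<le> W * T n"
    if "n0 < m" for m
    using that
  proof (induction m)
    case (Suc m)
    show ?case
    proof (cases "m = n0")
      case True
      obtain j where "1 \<le> j" "P n0 j" using step' by blast
      moreover have "p n0 + c2 \<le> W * T n0" using T[of n0] by (simp add: W_def)
      ultimately show ?thesis using True by (intro exI[of _ n0] exI[of _ j]) auto
    next
      case False
      then obtain n j where nj: "n0 \<le> n" "n < m" "m \<le> n + j" "P n j" "1 \<le> j" "p n + c2 \<le> W * T n"
        using Suc by auto
      show ?thesis
      proof (cases "Suc m \<le> n + j")
        case True
        with nj show ?thesis by (intro exI[of _ n] exI[of _ j]) auto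
      next
        case False
        with nj have m: "m = n + j" by simp
        obtain i where "1 \<le> i" "P m i" using step'[of m] nj by auto
        moreover have "p m + c2 \<le> W * T m" unfolding m by (rule advance) (use nj in auto)
        ultimately show ?thesis using nj by (intro exI[of _ m] exI[of _ i]) auto
      qed
    qed
  qed simp
  \<comment> \<open>Since \<open>\<eta> * ln j \<le> E n\<close>, the term
    \<open>(1 + \<eta>) * ln j\<close> costs at most \<open>(1 + \<eta>) / \<eta>\<close> further
    copies of \<open>E n\<close>.\<close>
  define V where "V = (1 + (1 + \<eta>) / \<eta>) * W"
  show thesis
  proof
    fix m assume "n0 < m"
    then obtain n j where nj: "n0 \<le> n" "n < m" "m \<le> n + j" "P n j" "p n + c2 \<le> W * T n"
      using cover by blast
    have "W \<ge> 0" using p0 c2 T by (auto simp: W_def less_imp_le intro!: divide_nonneg_pos)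
    have "ln (b m) \<le> ln (b (n + j))"
      using mono[of m "n + j"] b1[of m] nj n0 by (intro ln_mono) auto
    also have "\<dots> \<le> E n + (1 + \<eta>) / \<eta> * (\<eta> * ln (real j))"
      using nj(4) \<eta> by (simp add: P_def)
    also have "\<dots> \<le> E n + (1 + \<eta>) / \<eta> * E n"
      using nj(4) \<eta> by (intro add_left_mono mult_left_mono) (auto simp: P_def)
    also have "\<dots> = (1 + (1 + \<eta>) / \<eta>) * E n" by (simp add: algebra_simps)
    also have "E n \<le> K n * (p n + c2)"
    proof -
      have "1 * c' \<le> K n * c'" using K1[of n] c' by (rule mult_right_mono)
      moreover have "0 \<le> K n * (2 * (1 + \<eta>))"
        using K1[of n] \<eta> by (intro mult_nonneg_nonneg) auto
      ultimately show ?thesis by (simp add: E_def c2_def algebra_simps)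
    qed
    also have "K n * (p n + c2) \<le> K n * (W * T n)"
      using nj(5) K1[of n] by (intro mult_left_mono) auto
    \<comment> \<open>The factor \<open>K n\<close> is absorbed by the growth of \<open>T\<close>
      from \<open>n\<close> to \<open>n + 1\<close>, and \<open>n + 1 \<le> m\<close>.\<close>
    also have "\<dots> \<le> W * (T n * (1 + K n) ^ 1)"
      using \<open>W \<ge> 0\<close> T[of n] by (simp add: algebra_simps)
    also have "\<dots> \<le> W * T (n + 1)"
      using erdos_exponent_add_ge[OF D d, of n 1] nj(1) n0 \<open>W \<ge> 0\<close>
      unfolding T_def K_def by (intro mult_left_mono) auto
    also have "\<dots> \<le> W * T m"
      unfolding T_def using nj \<open>W \<ge> 0\<close> by (intro mult_left_mono erdos_exponent_mono D d) auto
    finally show "ln (b m) \<le> V * erdos_exponent D d m"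
      using \<eta> by (simp add: V_def T_def mult.assoc mult_left_mono)
  qed
qed

text \<open>If every term exceeded its bound, comparison with the convergent series of
  \<open>Suc j powr - (1 + \<eta>)\<close> would make the sum at most \<open>1 / (2 * B)\<close>,
  contradicting \<open>1 \<le> B * t\<close>.\<close>

lemma exists_small_term:
  fixes a :: "nat \<Rightarrow> real" and B t \<eta> :: real
  assumes \<eta>: "0 < \<eta>" and pos: "\<And>j. 0 < a j" and B: "0 < B" and sm: "summable (\<lambda>j. 1 / a j)"
    and t: "t \<le> (\<Sum>j. 1 / a j)" "1 \<le> B * t"
  shows "\<exists>j. a j \<le> 2 * (\<Sum>j. real (Suc j) powr - (1 + \<eta>)) * B * real (Suc j) powr (1 + \<eta>)"
proof (rule ccontr)
  define S where "S = (\<Sum>j. real (Suc j) powr - (1 + \<eta>))"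
  have smS: "summable (\<lambda>j. real (Suc j) powr - (1 + \<eta>))"
    using \<eta> summable_real_powr_iff[of "- (1 + \<eta>)"] by (subst summable_Suc_iff) auto
  have S: "0 < S" unfolding S_def by (intro suminf_pos smS) auto
  assume "\<not> ?thesis"
  then have gt: "2 * S * B * real (Suc j) powr (1 + \<eta>) < a j" for j by (auto simp: S_def not_le)
  have "1 / a j \<le> 1 / (2 * S * B) * real (Suc j) powr - (1 + \<eta>)" for j
  proof -
    have "1 / a j \<le> 1 / (2 * S * B * real (Suc j) powr (1 + \<eta>))"
      using gt[of j] S B pos by (intro divide_left_mono) auto
    also have "\<dots> = 1 / (2 * S * B) * real (Suc j) powr - (1 + \<eta>)"
      by (simp only: powr_minus_divide times_divide_times_eq mult_1)
    finally show ?thesis .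
  qed
  then have "(\<Sum>j. 1 / a j) \<le> (\<Sum>j. 1 / (2 * S * B) * real (Suc j) powr - (1 + \<eta>))"
    by (intro suminf_le sm summable_mult smS)
  also have "\<dots> = 1 / (2 * S * B) * S"
    unfolding S_def by (rule suminf_mult[OF smS])
  also have "\<dots> = 1 / (2 * B)" using S by simp
  finally have "B * t \<le> B * (1 / (2 * B))" using t B by (intro mult_left_mono) auto
  with t(2) B show False by simp
qed

theorem theorem1p1:
  fixes d D :: nat and \<epsilon> :: real and \<alpha> :: "nat \<Rightarrow> complex"
  assumes eps: "\<epsilon> > 0"
    and alg_int: "\<forall>n\<ge>1. algebraic_int (\<alpha> n)"
    and deg_bound: "\<forall>n\<ge>1. alg_degree (\<alpha> n) \<le> enat d"
    and deg_attained: "\<exists>n\<ge>1. alg_degree (\<alpha> n) = enat d"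
    and house_eq: "\<forall>n\<ge>1. norm (\<alpha> n) = house (\<alpha> n)"
    and mono: "\<forall>n\<ge>1. norm (\<alpha> n) \<le> norm (\<alpha> (Suc n))"
    and growth: "\<forall>\<^sub>F n in sequentially. norm (\<alpha> n) \<ge> real n powr (1 + \<epsilon>)"
    and re_im: "(\<forall>n\<ge>1. Re (\<alpha> n) > 0) \<or> (\<forall>n\<ge>1. Im (\<alpha> n) > 0)"
    and limsup: "limsup (\<lambda>n. ereal (house (\<alpha> n) powr
                   (1 / (real D ^ n * (\<Prod>i=1..<n. real d ^ i + real d))))) = \<infinity>"
  shows "alg_degree (\<Sum>n. 1 / \<alpha> (Suc n)) > enat D"
proof (rule ccontr)
  define s where "s = (\<Sum>n. 1 / \<alpha> (Suc n))"
  assume "\<not> ?thesis"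
  then have s: "algebraic s" "degree (min_poly s) \<le> D"
    by (auto simp: alg_degree_def s_def not_less split: if_splits)
  have D: "0 < D" using degree_min_poly_pos[OF s(1)] s(2) by simp
  have deg: "degree (min_poly (\<alpha> i)) \<le> d" if "1 \<le> i" for i
    using deg_bound alg_int that by (auto simp: alg_degree_def split: if_splits)
  have d: "0 < d"
    using degree_min_poly_pos[of "\<alpha> 1"] deg[of 1] alg_int by fastforce
  define a where "a = (\<lambda>n. norm (\<alpha> n))"
  \<comment> \<open>Truncation at 1 keeps all logarithms nonnegative and directly supplies the bound
    \<open>1 \<le> b n\<close> that the Liouville and growth lemmas require.\<close>
  define b where "b = (\<lambda>n. max 1 (a n))"
  have nz: "\<alpha> n \<noteq> 0" if "1 \<le> n" for n using re_im that by force
  then have a_pos: "0 < a n" if "1 \<le> n" for n using that by (simp add: a_def)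
  have a_mono: "a i \<le> a j" if "1 \<le> i" "i \<le> j" for i j
    using that(2,1)
  proof (induction j rule: dec_induct)
    case (step n)
    then have "a n \<le> a (Suc n)" using mono by (simp add: a_def)
    with step show ?case by simp
  qed simp
  have b1: "1 \<le> b n" and b_nz: "b n \<noteq> 0" and ab: "a n \<le> b n" for n by (auto simp: b_def)
  have b_mono: "b i \<le> b j" if "1 \<le> i" "i \<le> j" for i j
    using a_mono[OF that] by (auto simp: b_def)
  obtain n0 where n0: "1 \<le> n0" "\<And>n. n0 \<le> n \<Longrightarrow> real n powr (1 + \<epsilon>) \<le> a n"
  proof -
    obtain n1 where "\<And>n. n1 \<le> n \<Longrightarrow> real n powr (1 + \<epsilon>) \<le> a n"
      using growth unfolding eventually_sequentially a_def by blast
    then show ?thesis by (intro that[of "max 1 n1"]) auto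
  qed

  \<comment> \<open>Absolute convergence of the series of reciprocals\<close>
  have sm: "summable (\<lambda>n. 1 / a (Suc n))"
  proof (rule summable_comparison_test_ev)
    show "summable (\<lambda>n. real (Suc n) powr - (1 + \<epsilon>))"
      using eps summable_real_powr_iff[of "- (1 + \<epsilon>)"] by (subst summable_Suc_iff) auto
    show "\<forall>\<^sub>F n in sequentially. norm (1 / a (Suc n)) \<le> real (Suc n) powr - (1 + \<epsilon>)"
    proof (rule eventually_sequentiallyI)
      fix n assume "n0 \<le> n"
      then have "1 / a (Suc n) \<le> 1 / real (Suc n) powr (1 + \<epsilon>)"
        using n0(2)[of "Suc n"] a_pos[of "Suc n"] by (intro divide_left_mono) auto
      then show "norm (1 / a (Suc n)) \<le> real (Suc n) powr - (1 + \<epsilon>)"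
        using a_pos[of "Suc n"] unfolding powr_minus_divide by simp
    qed
  qed
  have sm_norm: "summable (\<lambda>n. norm (1 / \<alpha> (Suc n)))"
    using sm by (simp add: a_def norm_divide)
  have sm_c: "summable (\<lambda>n. 1 / \<alpha> (Suc n))" by (rule summable_norm_cancel[OF sm_norm])
  define \<sigma> where "\<sigma> = (\<Sum>n. 1 / a (Suc n))"
  have \<sigma>0: "0 \<le> \<sigma>" unfolding \<sigma>_def using a_pos by (intro suminf_nonneg sm) (auto simp: less_imp_le)
  have \<sigma>: "(\<Sum>i=1..N. 1 / b i) \<le> \<sigma>" for N
  proof -
    have "(\<Sum>i=1..N. 1 / b i) = (\<Sum>i<N. 1 / b (Suc i))"
      by (rule sum.reindex_bij_witness[of _ Suc "\<lambda>i. i - 1"]) auto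
    also have "\<dots> \<le> (\<Sum>i<N. 1 / a (Suc i))"
    proof (rule sum_mono)
      fix i
      show "1 / b (Suc i) \<le> 1 / a (Suc i)"
        using ab[of "Suc i"] b1[of "Suc i"] a_pos[of "Suc i"] by (intro divide_left_mono) auto
    qed
    also have "\<dots> \<le> \<sigma>"
      unfolding \<sigma>_def using a_pos by (intro sum_le_suminf sm) (auto simp: less_imp_le)
    finally show ?thesis .
  qed

  \<comment> \<open>Tails of the series and their nonvanishing\<close>
  define t where "t = (\<lambda>N. \<Sum>n. 1 / \<alpha> (Suc (n + N)))"
  have t: "s - (\<Sum>i=1..N. 1 / \<alpha> i) = t N" for N
  proof -
    have "(\<Sum>i=1..N. 1 / \<alpha> i) = (\<Sum>i<N. 1 / \<alpha> (Suc i))"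
      by (rule sum.reindex_bij_witness[of _ Suc "\<lambda>i. i - 1"]) auto
    then show ?thesis
      using suminf_split_initial_segment[OF sm_c, of N] by (simp add: s_def t_def)
  qed
  have sm_t: "summable (\<lambda>n. 1 / \<alpha> (Suc (n + N)))" for N
    using summable_ignore_initial_segment[OF sm_c, of N] by simp
  have t_nz: "t N \<noteq> 0" for N
  proof -
    \<comment> \<open>Inversion preserves the sign of the real part and reverses that of the
      imaginary part, so the terms of a tail cannot cancel.\<close>
    have cn: "1 / z = of_real (1 / (norm z)\<^sup>2) * cnj z" if "z \<noteq> 0" for z :: complex
      using complex_div_cnj[of 1 z] by simp
    show ?thesis using re_im
    proof
      assume re: "\<forall>n\<ge>1. Re (\<alpha> n) > 0"
      have "0 < (\<Sum>n. Re (1 / \<alpha> (Suc (n + N))))"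
      proof (rule suminf_pos)
        show "summable (\<lambda>n. Re (1 / \<alpha> (Suc (n + N))))" by (rule summable_Re[OF sm_t])
        show "0 < Re (1 / \<alpha> (Suc (n + N)))" for n
          using re nz[of "Suc (n + N)"] by (subst cn) auto
      qed
      also have "\<dots> = Re (t N)"
        unfolding t_def by (rule Re_suminf[OF sm_t, symmetric])
      finally show ?thesis by auto
    next
      assume im: "\<forall>n\<ge>1. Im (\<alpha> n) > 0"
      have "0 < (\<Sum>n. - Im (1 / \<alpha> (Suc (n + N))))"
      proof (rule suminf_pos)
        show "summable (\<lambda>n. - Im (1 / \<alpha> (Suc (n + N))))"
          by (intro summable_minus summable_Im sm_t)
        show "0 < - Im (1 / \<alpha> (Suc (n + N)))" for n
          using im nz[of "Suc (n + N)"] by (subst cn) auto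
      qed
      also have "\<dots> = - Im (t N)"
        unfolding t_def by (simp only: suminf_minus[OF summable_Im[OF sm_t]] Im_suminf[OF sm_t])
      finally show ?thesis by auto
    qed
  qed
  have sm_a: "summable (\<lambda>j. 1 / a (Suc (j + N)))" for N
    using summable_ignore_initial_segment[OF sm, of N] by simp
  have t_le: "norm (t N) \<le> (\<Sum>j. 1 / a (Suc (j + N)))" for N
  proof -
    have "norm (t N) \<le> (\<Sum>j. norm (1 / \<alpha> (Suc (j + N))))"
      unfolding t_def using sm_a[of N] by (intro summable_norm) (simp add: a_def norm_divide)
    then show ?thesis by (simp add: a_def norm_divide)
  qed

  \<comment> \<open>The Liouville bound for the tails\<close>
  obtain C where C: "1 \<le> C"
    and C_bound: "\<And>N \<alpha> b. \<lbrakk>\<And>i. i \<in> {1..N} \<Longrightarrow> algebraic_int (\<alpha> i) \<and> degree (min_poly (\<alpha> i)) \<le> d \<and> \<alpha> i \<noteq> 0;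
       \<And>i. i \<in> {1..N} \<Longrightarrow> 1 \<le> b i;
       \<And>i z. i \<in> {1..N} \<Longrightarrow> poly (min_poly (\<alpha> i)) z = 0 \<Longrightarrow> norm z \<le> b i;
       (\<Sum>i=1..N. 1 / b i) \<le> \<sigma>; s \<noteq> (\<Sum>i=1..N. 1 / \<alpha> i)\<rbrakk>
      \<Longrightarrow> 1 \<le> norm (s - (\<Sum>i=1..N. 1 / \<alpha> i)) * (C * (\<Prod>i=1..N. b i)) ^ (D * d ^ N)"
    using liouville_lower_bound[OF s \<sigma>0, of d] by blast
  have root_le: "norm z \<le> b i" if "1 \<le> i" "poly (min_poly (\<alpha> i)) z = 0" for i z
  proof -
    have "lead_coeff (min_poly (\<alpha> i)) = 1"
      using alg_int that by (intro min_poly_props algebraic_int_imp_algebraic) auto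
    then have "finite (conjugates (\<alpha> i))"
      unfolding conjugates_def by (intro poly_roots_finite) auto
    then have "norm z \<le> house (\<alpha> i)"
      unfolding house_def using that by (intro Max_ge) (auto simp: conjugates_def)
    also have "\<dots> = a i" using house_eq that by (simp add: a_def)
    finally show ?thesis using ab[of i] by simp
  qed
  have lower: "1 \<le> (C * (\<Prod>i=1..N. b i)) ^ (D * d ^ N) * norm (t N)" for N
  proof -
    have "1 \<le> norm (s - (\<Sum>i=1..N. 1 / \<alpha> i)) * (C * (\<Prod>i=1..N. b i)) ^ (D * d ^ N)"
    proof (rule C_bound)
      show "s \<noteq> (\<Sum>i=1..N. 1 / \<alpha> i)" using t[of N] t_nz[of N] by auto
    qed (use alg_int deg nz b1 root_le \<sigma> in auto)
    then show ?thesis unfolding t by (simp only: mult.commute)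
  qed

  \<comment> \<open>Logarithmic growth of the terms\<close>
  define \<eta> where "\<eta> = \<epsilon> / 2"
  have \<eta>: "0 < \<eta>" using eps by (simp add: \<eta>_def)
  define S where "S = (\<Sum>j. real (Suc j) powr - (1 + \<eta>))"
  have S1: "1 \<le> S"
  proof -
    have "summable (\<lambda>j. real (Suc j) powr - (1 + \<eta>))"
      using \<eta> summable_real_powr_iff[of "- (1 + \<eta>)"] by (subst summable_Suc_iff) auto
    from sum_le_suminf[OF this, of "{0}"] show ?thesis by (simp add: S_def)
  qed
  obtain V where V: "\<And>m. n0 < m \<Longrightarrow> ln (b m) \<le> V * erdos_exponent D d m"
  proof (rule ln_le_erdos_exponent[of D d n0 b "ln C" "ln (2 * S)" \<eta>])
    fix n assume n: "n0 \<le> n"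
    define B where "B = (C * (\<Prod>i=1..n. b i)) ^ (D * d ^ n)"
    have prod_pos: "0 < (\<Prod>i=1..n. b i)" using b1 by (intro prod_pos) (auto intro: less_le_trans[OF zero_less_one])
    have "1 * 1 \<le> C * (\<Prod>i=1..n. b i)" using C b1 by (intro mult_mono prod_ge_1) auto
    then have B1: "1 \<le> B" unfolding B_def by (intro one_le_power) simp
    have lnB: "ln B = real (D * d ^ n) * (ln C + (\<Sum>i=1..n. ln (b i)))"
    proof -
      have "ln (\<Prod>i=1..n. b i) = (\<Sum>i=1..n. ln (b i))"
        by (intro ln_prod) (auto simp: b_nz)
      then show ?thesis
        unfolding B_def using C prod_pos by (subst ln_realpow) (auto simp: ln_mult b_nz)
    qed
    have "\<exists>j. a (Suc (j + n)) \<le> 2 * S * B * real (Suc j) powr (1 + \<eta>)"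
      unfolding S_def
    proof (rule exists_small_term[where t = "norm (t n)"])
      show "1 \<le> B * norm (t n)" using lower by (simp add: B_def)
    qed (use \<eta> a_pos B1 sm_a t_le in auto)
    then obtain j' where j': "a (Suc (j' + n)) \<le> 2 * S * B * real (Suc j') powr (1 + \<eta>)" by blast
    \<comment> \<open>\<open>exists_small_term\<close> counts from 0, while the tail starts at
      \<open>a (n + 1)\<close>; the shift supplies \<open>1 \<le> j\<close>.\<close>
    define j where "j = Suc j'"
    define R where "R = 2 * S * B * real j powr (1 + \<eta>)"
    have j: "1 \<le> j" "a (n + j) \<le> R" using j' by (simp_all add: j_def R_def add.commute)
    have "1 * 1 * 1 * 1 \<le> R" unfolding R_def using S1 B1 j(1) \<eta>
      by (intro mult_mono ge_one_powr_ge_zero) auto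
    with j(2) have bR: "b (n + j) \<le> R" by (simp add: b_def)
    have lnR: "ln R = ln (2 * S) + ln B + (1 + \<eta>) * ln (real j)"
      unfolding R_def using S1 B1 j(1) by (simp add: ln_mult ln_powr)
    have le1: "ln (b (n + j)) \<le> ln R"
      using bR b1[of "n + j"] by (intro ln_mono) auto
    have "real j powr (1 + \<epsilon>) \<le> real (n + j) powr (1 + \<epsilon>)"
      using eps by (intro powr_mono2) auto
    also have "\<dots> \<le> a (n + j)" using n by (intro n0(2)) auto
    also note ab[of "n + j"]
    finally have "ln (real j powr (1 + \<epsilon>)) \<le> ln (b (n + j))"
      using j(1) by (intro ln_mono) auto
    then have "(1 + \<epsilon>) * ln (real j) \<le> ln R" using le1 j(1) by (simp add: ln_powr)
    \<comment> \<open>With \<open>\<epsilon> = 2 * \<eta>\<close>, the growth condition puts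
      \<open>(1 + 2 * \<eta>) * ln j\<close> against the \<open>(1 + \<eta>) * ln j\<close> in
      \<open>ln R\<close>; the difference \<open>\<eta> * ln j\<close> remains.\<close>
    then have "\<eta> * ln (real j) \<le> ln B + ln (2 * S)"
      unfolding lnR by (simp add: \<eta>_def algebra_simps)
    with j(1) le1 show "\<exists>j\<ge>1.
      ln (b (n + j)) \<le> real (D * d ^ n) * (ln C + (\<Sum>i=1..n. ln (b i))) + ln (2 * S) + (1 + \<eta>) * ln (real j) \<and>
      \<eta> * ln (real j) \<le> real (D * d ^ n) * (ln C + (\<Sum>i=1..n. ln (b i))) + ln (2 * S)"
      unfolding lnR lnB[symmetric] by (intro exI[of _ j]) auto
  qed (use D d n0 b1 b_mono C S1 \<eta> in auto)

  \<comment> \<open>Contradiction with the limsup condition\<close>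
  have "house (\<alpha> m) powr (1 / erdos_exponent D d m) \<le> exp V" if "n0 < m" for m
  proof -
    let ?T = "erdos_exponent D d m"
    have T: "0 < ?T" by (rule erdos_exponent_pos[OF D d])
    have "house (\<alpha> m) = a m" using house_eq that n0(1) by (simp add: a_def)
    then have "house (\<alpha> m) powr (1 / ?T) \<le> b m powr (1 / ?T)"
      using ab[of m] T by (auto simp: a_def intro!: powr_mono2)
    also have "\<dots> = exp (ln (b m) / ?T)" using b1[of m] by (simp add: powr_def)
    also have "\<dots> \<le> exp V" using V[OF that] T by (simp add: field_simps)
    finally show ?thesis .
  qed
  then have "\<forall>\<^sub>F m in sequentially. ereal (house (\<alpha> m) powr (1 / erdos_exponent D d m)) \<le> ereal (exp V)"
    by (intro eventually_sequentiallyI[of "Suc n0"]) auto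
  then have "limsup (\<lambda>m. ereal (house (\<alpha> m) powr (1 / erdos_exponent D d m))) \<le> ereal (exp V)"
    by (rule Limsup_bounded)
  with limsup show False by (simp add: erdos_exponent_def)
qed

end
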